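(* Let $d\ge1$, $x\in S_X=[0,1]^d$ and, for $n\ge1$, $N=\lfloor d\log(n)/\{(d+2)\log(2)\}\rfloor$. Suppose that $\mathcal V(x)=\mathcal V(x,(D_i,S_i)_{i=1}^N)$ is the cell containing $x$ of a centered random tree after $N$ steps. Suppose that $(X,Y),(X_i,Y_i)_{i\ge1}$ are i.i.d., that $\varepsilon=Y-g(X)$ is sub-Gaussian conditionally on $X$ with parameter $\sigma^2$, that $X$ has a density $f_X$ on $[0,1]^d$ with $f_X\ge b>0$ on $[0,1]^d$, and that $g$ is $L$-Lipschitz on $[0,1]^d$. Then there exists $C>0$, depending only on the parameters of the problem but not on $n$, such that with probability $1$ there is $n_0$ such that for all $n\ge n_0$, $$|\hat g_{\mathcal V}(x)-g(x)|\le C\,n^{-1/(d+2)}\,e^{2\sqrt{\log(n)\log\log(n)}}.$$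
   Context: Setting: $(X,Y)$ is a random vector in $\mathbb R^d\times\mathbb R$, $X\in S_X=[0,1]^d$, $g(x)=\mathbb E[Y\mid X=x]$, $\varepsilon=Y-g(X)$. Sub-Gaussian conditionally on $X$ with parameter $\sigma^2$: $\mathbb E[\varepsilon\mid X]=0$ and $\mathbb E[\exp(t\varepsilon)\mid X]\le\exp(t^2\sigma^2/2)$ a.s. for all $t\in\mathbb R$. Lipschitz is with respect to $\|\cdot\|_2$. Centered random tree, described locally around $x$: let $S_i=1/2$ for all $i$ and let $(D_i)_{i\ge1}$ be i.i.d. uniform on $\{1,\dots,d\}$, independent of the data. Start with the cell $[0,1]^d$. At step $i$, the side of the current cell containing $x$ in direction $D_i$ is split at its midpoint, giving two new cells, and the one containing $x$ is retained. $\mathcal V(x,(D_i,S_i)_{i=1}^N)$ is the cell containing $x$ after $N$ steps. The estimator based on the first $n$ observations is $$\hat g_{\mathcal V}(x)=\frac{\sum_{i=1}^nY_i\mathbf 1_{\mathcal V(x)}(X_i)}{\sum_{i=1}^n\mathbf 1_{\mathcal V(x)}(X_i)},\qquad0/0=0.$$ *)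

theory Defs
  imports "HOL-Probability.Probability"
begin

definition unit_cube :: "(real ^ 'd) set" where
  "unit_cube = cbox 0 1"

abbreviation sigma_of :: "'a measure \<Rightarrow> 'b measure \<Rightarrow> ('a \<Rightarrow> 'b) \<Rightarrow> 'a measure" where
  "sigma_of M N Z \<equiv> vimage_algebra (space M) Z N"

definition regression_function ::
    "'a measure \<Rightarrow> ('a \<Rightarrow> real ^ 'd) \<Rightarrow> ('a \<Rightarrow> real) \<Rightarrow> (real ^ 'd \<Rightarrow> real) \<Rightarrow> bool" where
  "regression_function M X Y g \<longleftrightarrow>
     integrable M Y \<and> g \<in> borel_measurable borel \<and>
     (AE \<omega> in M. real_cond_exp M (sigma_of M borel X) Y \<omega> = g (X \<omega>))"

text \<open>The exponential moment is a conditional expectation of a nonnegative function, so no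
  integrability of \<open>exp (t * \<epsilon> \<omega>)\<close> is presupposed.\<close>

definition cond_subgaussian ::
    "'a measure \<Rightarrow> ('a \<Rightarrow> real ^ 'd) \<Rightarrow> ('a \<Rightarrow> real) \<Rightarrow> real \<Rightarrow> bool" where
  "cond_subgaussian M X \<epsilon> s \<longleftrightarrow>
     integrable M \<epsilon> \<and>
     (AE \<omega> in M. real_cond_exp M (sigma_of M borel X) \<epsilon> \<omega> = 0) \<and>
     (\<forall>t. AE \<omega> in M.
        nn_cond_exp M (sigma_of M borel X) (\<lambda>\<omega>. ennreal (exp (t * \<epsilon> \<omega>))) \<omega>
          \<le> ennreal (exp (t\<^sup>2 * s / 2)))"

definition has_density_on_cube ::
    "'a measure \<Rightarrow> ('a \<Rightarrow> real ^ 'd) \<Rightarrow> (real ^ 'd \<Rightarrow> real) \<Rightarrow> bool" where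
  "has_density_on_cube M X f \<longleftrightarrow>
     distributed M lborel X (\<lambda>u. ennreal (f u) * indicator unit_cube u)"

definition side_midpoint :: "(real ^ 'd) set \<Rightarrow> 'd \<Rightarrow> real" where
  "side_midpoint A j = (Inf ((\<lambda>z. z $ j) ` A) + Sup ((\<lambda>z. z $ j) ` A)) / 2"

text \<open>The cell containing \<open>x\<close> after the splits in directions \<open>D 1, \<dots>, D N\<close>.
  The two children of a cell are its points with \<open>z $ j < m\<close> and those with \<open>z $ j \<ge> m\<close>, so
  points of the splitting hyperplane go to the upper child.\<close>

primrec centered_cell :: "real ^ 'd \<Rightarrow> (nat \<Rightarrow> 'd) \<Rightarrow> nat \<Rightarrow> (real ^ 'd) set" where
  "centered_cell x D 0 = unit_cube"
| "centered_cell x D (Suc k) =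
     (let A = centered_cell x D k; j = D (Suc k); m = side_midpoint A j
      in {z \<in> A. z $ j < m \<longleftrightarrow> x $ j < m})"

text \<open>The quotient is \<open>0\<close> when no observation lies in \<open>V\<close>, since \<open>0 / 0 = 0\<close>.\<close>

definition cell_estimator ::
    "(real ^ 'd) set \<Rightarrow> (nat \<Rightarrow> real ^ 'd) \<Rightarrow> (nat \<Rightarrow> real) \<Rightarrow> nat \<Rightarrow> real" where
  "cell_estimator V xs ys n =
     (\<Sum>i=1..n. ys i * indicator V (xs i)) / (\<Sum>i=1..n. indicator V (xs i))"

definition tree_depth :: "nat \<Rightarrow> nat \<Rightarrow> nat" where
  "tree_depth d n = nat \<lfloor>real d * ln (real n) / ((real d + 2) * ln 2)\<rfloor>"

text \<open>The index \<open>0\<close> carries the generic pair \<open>(X, Y)\<close>; the observations are those with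
  index \<open>i \<ge> 1\<close>.\<close>

definition iid_sample ::
    "'a measure \<Rightarrow> (nat \<Rightarrow> 'a \<Rightarrow> real ^ 'd) \<Rightarrow> (nat \<Rightarrow> 'a \<Rightarrow> real) \<Rightarrow> bool" where
  "iid_sample M X Y \<longleftrightarrow>
     prob_space.indep_vars M (\<lambda>_. borel) (\<lambda>i \<omega>. (X i \<omega>, Y i \<omega>)) UNIV \<and>
     (\<forall>i. distr M borel (\<lambda>\<omega>. (X i \<omega>, Y i \<omega>)) = distr M borel (\<lambda>\<omega>. (X 0 \<omega>, Y 0 \<omega>)))"

definition iid_uniform_directions :: "'a measure \<Rightarrow> (nat \<Rightarrow> 'a \<Rightarrow> 'd::finite) \<Rightarrow> bool" where
  "iid_uniform_directions M D \<longleftrightarrow>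
     prob_space.indep_vars M (\<lambda>_. count_space UNIV) D {1..} \<and>
     (\<forall>i\<ge>1. distr M (count_space UNIV) (D i) = uniform_count_measure UNIV)"

text \<open>Independence of the whole direction sequence and the whole data sequence. The constant
  \<open>indep_var\<close> requires both variables to have the same type, hence the formulation through the
  generated sigma-algebras.\<close>

definition directions_indep_of_data ::
    "'a measure \<Rightarrow> (nat \<Rightarrow> 'a \<Rightarrow> 'd::finite) \<Rightarrow> (nat \<Rightarrow> 'a \<Rightarrow> real ^ 'd) \<Rightarrow>
      (nat \<Rightarrow> 'a \<Rightarrow> real) \<Rightarrow> bool" where
  "directions_indep_of_data M D X Y \<longleftrightarrow>
     prob_space.indep_set M
       (sets (sigma_of M (PiM {1..} (\<lambda>_. count_space UNIV)) (\<lambda>\<omega>. \<lambda>i\<in>{1..}. D i \<omega>)))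
       (sets (sigma_of M (PiM UNIV (\<lambda>_. borel)) (\<lambda>\<omega> i. (X i \<omega>, Y i \<omega>))))"

end

(* The error splits into a noise average and a bias. At most d^N <= n^d cells can arise from N
   directions, so a union bound over all of them replaces conditioning on the tree. For one cell A
   with p <= P(X in A), a Chernoff bound puts at least n p / 2 observations in A, and
   exp (t W - t^2 sigma^2 S / 2) has expectation at most 1, where W is the sum of the noise over the
   S observations in A. Markov's inequality at the single value t = sqrt (2 u / (n p)) then controls
   W / S. The bias is at most L times the sum over j of 2^(-T j), where T j is the number of
   splits in direction j among the first N. Hoeffding's inequality gives
   T j >= N / d - sqrt (N ln N) outside an event of probability N^(-2). That is summable in N but
   would not be in n, so Borel-Cantelli is applied along depths and then composed with the map from n
   to its depth. *)

theory Submission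
  imports Defs "HOL-Real_Asymp.Real_Asymp"
begin

section \<open>Geometry of the cells\<close>

definition split_count :: "(nat \<Rightarrow> 'd) \<Rightarrow> nat \<Rightarrow> 'd \<Rightarrow> nat" where
  "split_count D N j = card {i\<in>{1..N}. D i = j}"

lemma split_count_0 [simp]: "split_count D 0 j = 0"
  by (simp add: split_count_def)

lemma split_count_Suc:
  "split_count D (Suc N) j = split_count D N j + (if D (Suc N) = j then 1 else 0)"
proof -
  have "{i\<in>{1..Suc N}. D i = j} =
      (if D (Suc N) = j then insert (Suc N) {i\<in>{1..N}. D i = j} else {i\<in>{1..N}. D i = j})"
    by (auto simp: le_Suc_eq)
  then show ?thesis by (simp add: split_count_def)
qed

lemma sum_split_count:
  fixes D :: "nat \<Rightarrow> 'd::finite"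
  shows "(\<Sum>j\<in>UNIV. split_count D N j) = N"
  by (induction N) (simp_all add: split_count_Suc sum.distrib)

text \<open>In this form the count is a sum of bounded variables, one per split, to which
  Hoeffding's inequality applies.\<close>

lemma real_split_count: "real (split_count D N j) = (\<Sum>i=1..N. indicator {j} (D i))"
  by (induction N) (simp_all add: split_count_Suc indicator_def)

text \<open>Only the first \<open>N\<close> directions enter, so a fixed depth produces finitely
  many cells. This makes a union bound over all direction sequences possible.\<close>

lemma centered_cell_cong:
  assumes "\<And>i. i \<in> {1..N} \<Longrightarrow> D i = D' i"
  shows "centered_cell x D N = centered_cell x D' N"
  using assms by (induction N) (simp_all add: Let_def)

lemma centered_cell_mem: "x \<in> unit_cube \<Longrightarrow> x \<in> centered_cell x D N"
  by (induction N) (simp_all add: Let_def)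

lemma centered_cell_subset: "centered_cell x D N \<subseteq> unit_cube"
  by (induction N) (auto simp: Let_def)

lemma centered_cell_borel [measurable]:
  fixes x :: "real ^ 'd::finite"
  shows "centered_cell x D N \<in> sets borel"
proof (induction N)
  case 0
  show ?case by (simp add: unit_cube_def)
next
  case (Suc N)
  define m where "m = side_midpoint (centered_cell x D N) (D (Suc N))"
  have "centered_cell x D (Suc N) =
      centered_cell x D N \<inter> {z. z $ D (Suc N) < m \<longleftrightarrow> x $ D (Suc N) < m}"
    by (auto simp: Let_def m_def)
  moreover have "{z :: real ^ 'd. z $ D (Suc N) < m \<longleftrightarrow> x $ D (Suc N) < m} \<in> sets borel"
    by (cases "x $ D (Suc N) < m") (simp_all add: not_less)
  ultimately show ?case using Suc by simp
qed

text \<open>The open box already projects onto the whole open interval between the corner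
  coordinates, so the infimum and supremum do not depend on which faces belong to
  \<open>A\<close>.\<close>

lemma side_midpoint_between:
  fixes l u :: "real ^ 'd::finite"
  assumes lu: "\<And>i. l $ i < u $ i" and A: "box l u \<subseteq> A" "A \<subseteq> cbox l u"
  shows "side_midpoint A j = (l $ j + u $ j) / 2"
proof -
  let ?P = "(\<lambda>z. z $ j) ` A"
  have up: "?P \<subseteq> {l $ j .. u $ j}"
    using A(2) by (auto simp: mem_box_cart)
  have low: "{l $ j <..< u $ j} \<subseteq> ?P"
  proof
    fix t assume t: "t \<in> {l $ j <..< u $ j}"
    \<comment> \<open>A point of the open box with prescribed coordinate \<open>j\<close>; all other
      coordinates sit at the middle of their sides.\<close>
    define z :: "real ^ 'd" where "z = (\<chi> i. if i = j then t else (l $ i + u $ i) / 2)"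
    have "z \<in> box l u" using t lu by (auto simp: z_def mem_box_cart field_simps)
    moreover have "z $ j = t" by (simp add: z_def)
    ultimately show "t \<in> ?P" using A(1) by force
  qed
  have ne: "{l $ j <..< u $ j} \<noteq> {}" using lu[of j] by (simp add: not_le)
  then have neP: "?P \<noteq> {}" using low by blast
  have bdd: "bdd_below ?P" "bdd_above ?P"
    using bdd_below_mono[OF _ up] bdd_above_mono[OF _ up] by auto
  have "Inf ?P = l $ j"
  proof (rule antisym)
    show "Inf ?P \<le> l $ j"
      using cInf_superset_mono[OF ne bdd(1) low] lu[of j] by simp
    show "l $ j \<le> Inf ?P" using cInf_greatest[OF neP] up by fastforce
  qed
  moreover have "Sup ?P = u $ j"
  proof (rule antisym)
    show "u $ j \<le> Sup ?P"
      using cSup_subset_mono[OF ne bdd(2) low] lu[of j] by simp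
    show "Sup ?P \<le> u $ j" using cSup_least[OF neP] up by fastforce
  qed
  ultimately show ?thesis by (simp add: side_midpoint_def)
qed

text \<open>Which faces belong to the cell depends on the splits, hence the sandwich between the open
  and the closed box.\<close>

lemma centered_cell_box:
  fixes x :: "real ^ 'd::finite"
  shows "\<exists>l u. (\<forall>j. u $ j - l $ j = (1/2) ^ split_count D N j) \<and>
           box l u \<subseteq> centered_cell x D N \<and> centered_cell x D N \<subseteq> cbox l u"
proof (induction N)
  case 0
  show ?case
    by (intro exI[of _ 0] exI[of _ 1]) (simp add: unit_cube_def box_subset_cbox)
next
  case (Suc N)
  then obtain l u :: "real ^ 'd" where
    lu: "\<And>j. u $ j - l $ j = (1/2) ^ split_count D N j" and
    A: "box l u \<subseteq> centered_cell x D N" "centered_cell x D N \<subseteq> cbox l u"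
    by blast
  have less: "l $ j < u $ j" for j
    using lu[of j] by (smt (verit) half_gt_zero_iff zero_less_power)
  define k where "k = D (Suc N)"
  define m where "m = (l $ k + u $ k) / 2"
  have m: "side_midpoint (centered_cell x D N) k = m"
    unfolding m_def by (rule side_midpoint_between[OF less A])
  have cell: "centered_cell x D (Suc N) =
      {z \<in> centered_cell x D N. z $ k < m \<longleftrightarrow> x $ k < m}"
    by (simp add: Let_def m flip: k_def)
  show ?case
  proof (cases "x $ k < m")
    case True
    \<comment> \<open>Keeping the lower child moves only the upper corner, and only in coordinate
      \<open>k\<close>: that side halves while its split count grows by one. The other case moves
      the lower corner instead.\<close>
    define u' :: "real ^ 'd" where "u' = (\<chi> j. if j = k then m else u $ j)"
    have "u' $ j - l $ j = (1/2) ^ split_count D (Suc N) j" for j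
      using lu[of j] by (auto simp: u'_def split_count_Suc k_def[symmetric] m_def field_simps)
    moreover have "box l u' \<subseteq> centered_cell x D (Suc N)"
    proof
      fix z assume z: "z \<in> box l u'"
      have k: "z $ k < m" using z by (auto simp: mem_box_cart u'_def dest: spec[of _ k])
      have "z \<in> box l u"
        unfolding mem_box_cart
      proof
        fix j show "l $ j < z $ j \<and> z $ j < u $ j"
          using z k less[of k]
          by (cases "j = k") (auto simp: mem_box_cart u'_def m_def dest: spec[of _ j])
      qed
      then show "z \<in> centered_cell x D (Suc N)" using A(1) k True by (auto simp: cell simp del: centered_cell.simps)
    qed
    moreover have "centered_cell x D (Suc N) \<subseteq> cbox l u'"
      using A(2) True by (auto simp: cell mem_box_cart u'_def subset_iff simp del: centered_cell.simps)
    ultimately show ?thesis by blast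
  next
    case False
    define l' :: "real ^ 'd" where "l' = (\<chi> j. if j = k then m else l $ j)"
    have "u $ j - l' $ j = (1/2) ^ split_count D (Suc N) j" for j
      using lu[of j] by (auto simp: l'_def split_count_Suc k_def[symmetric] m_def field_simps)
    moreover have "box l' u \<subseteq> centered_cell x D (Suc N)"
    proof
      fix z assume z: "z \<in> box l' u"
      have k: "\<not> z $ k < m" using z by (auto simp: mem_box_cart l'_def dest: spec[of _ k])
      have "z \<in> box l u"
        unfolding mem_box_cart
      proof
        fix j show "l $ j < z $ j \<and> z $ j < u $ j"
          using z k less[of k]
          by (cases "j = k") (auto simp: mem_box_cart l'_def m_def dest: spec[of _ j])
      qed
      then show "z \<in> centered_cell x D (Suc N)" using A(1) k False by (auto simp: cell simp del: centered_cell.simps)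
    qed
    moreover have "centered_cell x D (Suc N) \<subseteq> cbox l' u"
      using A(2) False by (auto simp: cell mem_box_cart l'_def subset_iff simp del: centered_cell.simps)
    ultimately show ?thesis by blast
  qed
qed

text \<open>The volume of the inner open box is the product of its sides. Every split raises exactly
  one count, so the exponents add up to \<open>N\<close> whatever the directions are.\<close>

lemma emeasure_centered_cell:
  fixes x :: "real ^ 'd::finite"
  shows "ennreal ((1/2) ^ N) \<le> emeasure lborel (centered_cell x D N)"
proof -
  obtain l u :: "real ^ 'd" where
    lu: "\<And>j. u $ j - l $ j = (1/2) ^ split_count D N j" and A: "box l u \<subseteq> centered_cell x D N"
    using centered_cell_box[of D N x] by blast
  have le: "l $ j \<le> u $ j" for j
    using lu[of j] by (smt (verit) half_gt_zero_iff zero_less_power)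
  have "(\<Prod>b\<in>Basis. (u - l) \<bullet> b) = (\<Prod>j\<in>UNIV. u $ j - l $ j)"
    by (simp add: Basis_vec_def cart_eq_inner_axis axis_eq_axis prod.UNION_disjoint inner_diff_left)
  also have "\<dots> = (1/2) ^ N"
    by (simp add: lu power_sum[symmetric] sum_split_count)
  finally have "emeasure lborel (box l u) = ennreal ((1/2) ^ N)"
    using le by (subst emeasure_lborel_box) (auto simp: Basis_vec_def inner_axis)
  then show ?thesis using emeasure_mono[OF A, of lborel] by simp
qed

text \<open>The Euclidean norm is at most the sum of the absolute coordinates, each bounded by a
  side length. The loss is at most a factor depending on the dimension, which the final constant
  absorbs.\<close>

lemma centered_cell_norm_le:
  fixes x :: "real ^ 'd::finite"
  assumes "y \<in> centered_cell x D N" "z \<in> centered_cell x D N"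
  shows "norm (y - z) \<le> (\<Sum>j\<in>UNIV. (1/2) ^ split_count D N j)"
proof -
  obtain l u :: "real ^ 'd" where
    lu: "\<And>j. u $ j - l $ j = (1/2) ^ split_count D N j" and A: "centered_cell x D N \<subseteq> cbox l u"
    using centered_cell_box[of D N x] by blast
  have "norm (y - z) \<le> (\<Sum>j\<in>UNIV. \<bar>(y - z) $ j\<bar>)"
    by (rule norm_le_l1_cart)
  also have "\<dots> \<le> (\<Sum>j\<in>UNIV. (1/2) ^ split_count D N j)"
  proof (rule sum_mono)
    fix j
    have "y \<in> cbox l u" "z \<in> cbox l u" using assms A by auto
    then have "l $ j \<le> y $ j" "y $ j \<le> u $ j" "l $ j \<le> z $ j" "z $ j \<le> u $ j"
      by (simp_all add: mem_box_cart)
    then show "\<bar>(y - z) $ j\<bar> \<le> (1/2) ^ split_count D N j"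
      using lu[of j] by simp
  qed
  finally show ?thesis .
qed

section \<open>Noise in one cell\<close>

text \<open>Markov's inequality for the exponential of the sum, which factorizes by independence.
  Nonnegative integrals make integrability a consequence of the bound \<open>c\<close>. Any
  exponential parameter is already contained in \<open>h\<close>, so the lemma serves both the
  number of observations in a cell and their noise.\<close>

lemma (in prob_space) chernoff_iid:
  fixes Z :: "nat \<Rightarrow> 'a \<Rightarrow> 'b::topological_space" and h :: "'b \<Rightarrow> real"
  assumes indep: "indep_vars (\<lambda>_. borel) Z UNIV"
    and distr: "\<And>i. distr M borel (Z i) = distr M borel (Z 0)"
    and h [measurable]: "h \<in> borel_measurable borel"
    and c: "(\<integral>\<^sup>+\<omega>. ennreal (exp (h (Z 0 \<omega>))) \<partial>M) \<le> ennreal c" "0 \<le> c"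
  shows "prob {\<omega>\<in>space M. a \<le> (\<Sum>i=1..n. h (Z i \<omega>))} \<le> c ^ n * exp (- a)"
proof -
  have Z [measurable]: "Z i \<in> borel_measurable M" for i
    using indep by (simp add: indep_vars_def)
  let ?E = "{\<omega>\<in>space M. a \<le> (\<Sum>i=1..n. h (Z i \<omega>))}"
  have same: "(\<integral>\<^sup>+\<omega>. ennreal (exp (h (Z i \<omega>))) \<partial>M) = (\<integral>\<^sup>+\<omega>. ennreal (exp (h (Z 0 \<omega>))) \<partial>M)" for i
  proof -
    have "(\<integral>\<^sup>+\<omega>. ennreal (exp (h (Z i \<omega>))) \<partial>M) = (\<integral>\<^sup>+z. ennreal (exp (h z)) \<partial>distr M borel (Z i))" for i
      by (subst nn_integral_distr) auto
    then show ?thesis using distr[of i] by simp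
  qed
  have "indep_vars (\<lambda>_. borel) (\<lambda>i \<omega>. ennreal (exp (h (Z i \<omega>)))) UNIV"
    by (rule indep_vars_compose2[OF indep]) simp
  then have "indep_vars (\<lambda>_. borel) (\<lambda>i \<omega>. ennreal (exp (h (Z i \<omega>)))) {1..n}"
    by (rule indep_vars_subset) simp
  then have "(\<integral>\<^sup>+\<omega>. (\<Prod>i=1..n. ennreal (exp (h (Z i \<omega>)))) \<partial>M)
      = (\<Prod>i=1..n. \<integral>\<^sup>+\<omega>. ennreal (exp (h (Z i \<omega>))) \<partial>M)"
    by (intro indep_vars_nn_integral) auto
  also have "\<dots> = (\<Prod>i=1..n. \<integral>\<^sup>+\<omega>. ennreal (exp (h (Z 0 \<omega>))) \<partial>M)"
    by (rule prod.cong[OF refl same])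
  also have "\<dots> = (\<integral>\<^sup>+\<omega>. ennreal (exp (h (Z 0 \<omega>))) \<partial>M) ^ n"
    by simp
  also have "\<dots> \<le> ennreal (c ^ n)"
    using power_mono[OF c(1), of n] c(2) by (simp add: ennreal_power)
  finally have int: "(\<integral>\<^sup>+\<omega>. ennreal (exp (\<Sum>i=1..n. h (Z i \<omega>))) \<partial>M) \<le> ennreal (c ^ n)"
    by (simp add: exp_sum prod_ennreal)
  have "emeasure M ?E = (\<integral>\<^sup>+\<omega>. indicator ?E \<omega> \<partial>M)"
    by simp
  also have "\<dots> \<le> (\<integral>\<^sup>+\<omega>. ennreal (exp (- a)) * ennreal (exp (\<Sum>i=1..n. h (Z i \<omega>))) \<partial>M)"
  proof (rule nn_integral_mono)
    fix \<omega>
    have "1 \<le> exp (- a) * exp (\<Sum>i=1..n. h (Z i \<omega>))" if "\<omega> \<in> ?E"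
      using that by (simp flip: exp_add)
    then show "indicator ?E \<omega> \<le> ennreal (exp (- a)) * ennreal (exp (\<Sum>i=1..n. h (Z i \<omega>)))"
      by (auto simp: indicator_def ennreal_mult[symmetric] simp flip: ennreal_1 intro!: ennreal_leI)
  qed
  also have "\<dots> = ennreal (exp (- a)) * (\<integral>\<^sup>+\<omega>. ennreal (exp (\<Sum>i=1..n. h (Z i \<omega>))) \<partial>M)"
    by (rule nn_integral_cmult) simp
  also have "\<dots> \<le> ennreal (exp (- a)) * ennreal (c ^ n)"
    by (rule mult_left_mono[OF int]) simp
  also have "\<dots> = ennreal (c ^ n * exp (- a))"
    using c(2) by (simp add: ennreal_mult mult.commute)
  finally show ?thesis
    using c(2) by (simp add: emeasure_eq_measure)
qed

text \<open>Off \<open>A\<close> the integrand is 1. On \<open>A\<close> conditioning on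
  \<open>X\<close> bounds the exponential moment, and the compensator
  \<open>t\<^sup>2 * s / 2\<close> cancels the bound exactly. Multiplying the whole exponent by the
  indicator keeps the bound at 1 however many observations fall into \<open>A\<close>.\<close>

lemma (in prob_space) cond_subgaussian_exp_le_1:
  fixes X :: "'a \<Rightarrow> real ^ 'd::finite" and t s :: real
  assumes X [measurable]: "X \<in> borel_measurable M" and A [measurable]: "A \<in> sets borel"
    and sub: "cond_subgaussian M X \<epsilon> s"
  shows "(\<integral>\<^sup>+\<omega>. ennreal (exp ((t * \<epsilon> \<omega> - t\<^sup>2 * s / 2) * indicator A (X \<omega>))) \<partial>M) \<le> ennreal 1"
proof -
  have eps [measurable]: "\<epsilon> \<in> borel_measurable M"
    using sub by (simp add: cond_subgaussian_def borel_measurable_integrable)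
  define F where "F = sigma_of M borel X"
  interpret F: finite_measure_subalgebra M F
  proof
    show "subalgebra M F"
      by (auto simp: subalgebra_def F_def sets_vimage_algebra2 intro: measurable_sets[OF X])
  qed
  have XF [measurable]: "X \<in> F \<rightarrow>\<^sub>M borel"
    unfolding F_def by (rule measurable_vimage_algebra1) simp
  let ?c = "exp (- (t\<^sup>2 * s / 2))"
  \<comment> \<open>The factor that depends on \<open>X\<close> alone is measurable with respect to
    \<open>F\<close>, so it may be moved across the conditional expectation.\<close>
  define f where "f \<omega> = ennreal ?c * indicator A (X \<omega>)" for \<omega>
  have f [measurable]: "f \<in> borel_measurable F" unfolding f_def by simp
  have fM [measurable]: "f \<in> borel_measurable M" unfolding f_def by simp
  have bound: "AE \<omega> in M. nn_cond_exp M F (\<lambda>\<omega>. ennreal (exp (t * \<epsilon> \<omega>))) \<omega> \<le> ennreal (exp (t\<^sup>2 * s / 2))"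
    using sub by (simp add: cond_subgaussian_def F_def)
  have "(\<integral>\<^sup>+\<omega>. f \<omega> * ennreal (exp (t * \<epsilon> \<omega>)) \<partial>M)
      = (\<integral>\<^sup>+\<omega>. f \<omega> * nn_cond_exp M F (\<lambda>\<omega>. ennreal (exp (t * \<epsilon> \<omega>))) \<omega> \<partial>M)"
    by (rule F.nn_cond_exp_intg[symmetric]) simp_all
  also have "\<dots> \<le> (\<integral>\<^sup>+\<omega>. f \<omega> * ennreal (exp (t\<^sup>2 * s / 2)) \<partial>M)"
    by (rule nn_integral_mono_AE) (use bound in eventually_elim, auto intro: mult_left_mono)
  also have "\<dots> = (\<integral>\<^sup>+\<omega>. indicator A (X \<omega>) \<partial>M)"
  proof (rule nn_integral_cong)
    fix \<omega>
    have "ennreal ?c * ennreal (exp (t\<^sup>2 * s / 2)) = 1"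
      by (simp flip: ennreal_mult exp_add)
    then show "f \<omega> * ennreal (exp (t\<^sup>2 * s / 2)) = indicator A (X \<omega>)"
      by (simp add: f_def indicator_def)
  qed
  finally have le: "(\<integral>\<^sup>+\<omega>. f \<omega> * ennreal (exp (t * \<epsilon> \<omega>)) \<partial>M) \<le> (\<integral>\<^sup>+\<omega>. indicator A (X \<omega>) \<partial>M)" .
  have "(\<integral>\<^sup>+\<omega>. ennreal (exp ((t * \<epsilon> \<omega> - t\<^sup>2 * s / 2) * indicator A (X \<omega>))) \<partial>M)
      = (\<integral>\<^sup>+\<omega>. f \<omega> * ennreal (exp (t * \<epsilon> \<omega>)) + indicator (- A) (X \<omega>) \<partial>M)"
    by (rule nn_integral_cong) (auto simp: f_def indicator_def algebra_simps simp flip: ennreal_mult exp_add)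
  also have "\<dots> = (\<integral>\<^sup>+\<omega>. f \<omega> * ennreal (exp (t * \<epsilon> \<omega>)) \<partial>M) + (\<integral>\<^sup>+\<omega>. indicator (- A) (X \<omega>) \<partial>M)"
    by (rule nn_integral_add) simp_all
  also have "\<dots> \<le> (\<integral>\<^sup>+\<omega>. indicator A (X \<omega>) \<partial>M) + (\<integral>\<^sup>+\<omega>. indicator (- A) (X \<omega>) \<partial>M)"
    by (rule add_right_mono[OF le])
  also have "\<dots> = (\<integral>\<^sup>+\<omega>. indicator A (X \<omega>) + indicator (- A) (X \<omega>) \<partial>M)"
    by (rule nn_integral_add[symmetric]) simp_all
  also have "\<dots> = (\<integral>\<^sup>+\<omega>. 1 \<partial>M)"
    by (rule nn_integral_cong) (simp add: indicator_def)
  also have "\<dots> = ennreal 1" by (simp add: emeasure_space_1)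
  finally show ?thesis .
qed

text \<open>The Laplace transform at 1 of an indicator of probability \<open>P\<close> is
  \<open>1 - (1 - exp (-1)) * P\<close>. Since \<open>exp 1\<close> is at least 1 + 1 + 1/2, the
  factor is at least 3/5. What matters is that 3/5 exceeds 1/2: the surplus gives an exponential
  bound for the event of at most half the expected count.\<close>

lemma (in prob_space) exp_neg_indicator_le:
  assumes X [measurable]: "X \<in> M \<rightarrow>\<^sub>M N" and A [measurable]: "A \<in> sets N"
    and p: "p \<le> prob {\<omega>\<in>space M. X \<omega> \<in> A}"
  shows "(\<integral>\<^sup>+\<omega>. ennreal (exp (- indicator A (X \<omega>))) \<partial>M) \<le> ennreal (exp (- (3/5) * p))"
proof -
  let ?E = "{\<omega>\<in>space M. X \<omega> \<in> A}"
  have E [measurable]: "?E \<in> sets M" by simp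
  have "5 / 2 \<le> exp (1::real)"
    using exp_lower_Taylor_quadratic[of 1] by simp
  then have e: "exp (-1) \<le> (2/5 :: real)"
    by (simp add: exp_minus field_simps)
  have "(\<integral>\<^sup>+\<omega>. ennreal (exp (- indicator A (X \<omega>))) \<partial>M)
      = (\<integral>\<^sup>+\<omega>. ennreal (1 - (1 - exp (-1)) * indicator ?E \<omega>) \<partial>M)"
    by (rule nn_integral_cong) (auto simp: indicator_def)
  also have "\<dots> = ennreal (\<integral>\<omega>. 1 - (1 - exp (-1)) * indicator ?E \<omega> \<partial>M)"
  proof (rule nn_integral_eq_integral)
    show "integrable M (\<lambda>\<omega>. 1 - (1 - exp (-1)) * indicator ?E \<omega> :: real)"
      by (intro Bochner_Integration.integrable_diff integrable_mult_right integrable_const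
          integrable_real_indicator) (simp_all add: less_top[symmetric])
  qed (auto simp: indicator_def)
  also have "(\<integral>\<omega>. 1 - (1 - exp (-1)) * indicator ?E \<omega> \<partial>M) = 1 - (1 - exp (-1)) * prob ?E"
    by (subst Bochner_Integration.integral_diff) (simp_all add: prob_space less_top[symmetric])
  also have "\<dots> \<le> 1 - (3/5) * p"
  proof -
    have "(3/5) * p \<le> (3/5) * prob ?E" using p by simp
    also have "\<dots> \<le> (1 - exp (-1)) * prob ?E"
      using e by (intro mult_right_mono) auto
    finally show ?thesis by simp
  qed
  also have "\<dots> \<le> exp (- (3/5) * p)"
    using exp_ge_add_one_self[of "- (3/5) * p"] by simp
  finally show ?thesis by (simp add: ennreal_leI)
qed

text \<open>After subtracting \<open>c\<close> times the count, the numerator is noise plus bias,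
  and each is compared with the count. A positive count excludes the value given to
  \<open>0 / 0\<close>.\<close>

lemma cell_estimator_error_le:
  fixes ys :: "nat \<Rightarrow> real" and xs :: "nat \<Rightarrow> real ^ 'd::finite"
  assumes V: "\<And>z. z \<in> V \<Longrightarrow> \<bar>g z - c\<bar> \<le> \<delta>"
    and S: "0 < (\<Sum>i=1..n. indicator V (xs i) :: real)"
    and noise: "\<bar>\<Sum>i=1..n. (ys i - g (xs i)) * indicator V (xs i)\<bar>
        \<le> \<eta> * (\<Sum>i=1..n. indicator V (xs i))"
  shows "\<bar>cell_estimator V xs ys n - c\<bar> \<le> \<eta> + \<delta>"
proof -
  let ?S = "\<Sum>i=1..n. indicator V (xs i) :: real"
  let ?W = "\<Sum>i=1..n. (ys i - g (xs i)) * indicator V (xs i)"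
  let ?B = "\<Sum>i=1..n. (g (xs i) - c) * indicator V (xs i)"
  have "(\<Sum>i=1..n. ys i * indicator V (xs i)) = ?W + ?B + c * ?S"
    unfolding sum.distrib[symmetric] sum_distrib_left
    by (rule sum.cong) (simp_all add: algebra_simps)
  then have "cell_estimator V xs ys n - c = (?W + ?B) / ?S"
    using S by (simp add: cell_estimator_def field_simps)
  then have "\<bar>cell_estimator V xs ys n - c\<bar> = \<bar>?W + ?B\<bar> / ?S"
    using S by (simp add: abs_divide)
  also have "\<dots> \<le> (\<eta> * ?S + \<delta> * ?S) / ?S"
  proof (rule divide_right_mono)
    have "\<bar>?B\<bar> \<le> (\<Sum>i=1..n. \<bar>(g (xs i) - c) * indicator V (xs i)\<bar>)"
      by (rule sum_abs)
    also have "\<dots> \<le> (\<Sum>i=1..n. \<delta> * indicator V (xs i))"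
      by (rule sum_mono) (use V in \<open>auto simp: indicator_def\<close>)
    finally have "\<bar>?B\<bar> \<le> \<delta> * ?S" by (simp add: sum_distrib_left)
    then show "\<bar>?W + ?B\<bar> \<le> \<eta> * ?S + \<delta> * ?S" using noise by linarith
  qed (use S in simp)
  also have "\<dots> = \<eta> + \<delta>" using S by (simp add: field_simps)
  finally show ?thesis .
qed

text \<open>The count in the cell is random, but the exponential parameter is fixed from the lower
  bound \<open>real n * p / 2\<close> for that count. Once the count exceeds this bound, the
  deviation level \<open>u\<close> itself is dominated by a multiple of the count, and dividing by
  the parameter bounds the noise relative to the count.\<close>

lemma (in prob_space) sample_cell_deviation:
  fixes X :: "nat \<Rightarrow> 'a \<Rightarrow> real ^ 'd::finite"
  assumes iid: "iid_sample M X Y" and g [measurable]: "g \<in> borel_measurable borel"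
    and sub: "cond_subgaussian M (X 0) (\<lambda>\<omega>. Y 0 \<omega> - g (X 0 \<omega>)) s"
    and A [measurable]: "A \<in> sets borel"
    and p: "0 < p" "p \<le> prob {\<omega>\<in>space M. X 0 \<omega> \<in> A}" and n: "0 < n" and u: "0 < u"
  defines "S \<equiv> \<lambda>\<omega>. \<Sum>i=1..n. indicator A (X i \<omega>)"
    and "W \<equiv> \<lambda>\<omega>. \<Sum>i=1..n. (Y i \<omega> - g (X i \<omega>)) * indicator A (X i \<omega>)"
  shows "\<exists>E\<in>sets M. prob E \<le> exp (- (real n * p / 10)) + 2 * exp (- u) \<and>
           (\<forall>\<omega>\<in>space M - E. real n * p / 2 < S \<omega> \<and>
              \<bar>W \<omega>\<bar> \<le> (s / 2 + 1) * sqrt (2 * u / (real n * p)) * S \<omega>)"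
proof -
  define Z where "Z i \<omega> = (X i \<omega>, Y i \<omega>)" for i \<omega>
  have indep: "indep_vars (\<lambda>_. borel) Z UNIV"
    and distr: "distr M borel (Z i) = distr M borel (Z 0)" for i
    using iid by (simp_all add: iid_sample_def Z_def[abs_def])
  have Z [measurable]: "Z i \<in> borel_measurable M" for i
    using indep by (simp add: indep_vars_def)
  have "(\<lambda>\<omega>. fst (Z 0 \<omega>)) \<in> borel_measurable M"
    using measurable_compose[OF Z[of 0, folded borel_prod] measurable_fst] .
  then have X0 [measurable]: "X 0 \<in> borel_measurable M" by (simp add: Z_def[abs_def])
  \<comment> \<open>The exponential parameter, chosen so that \<open>r\<^sup>2\<close> times the
    guaranteed count equals \<open>u\<close>. It is used with both signs to control the absolute
    value.\<close>
  define r where "r = sqrt (2 * u / (real n * p))"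
  have r: "0 < r" using n p(1) u by (simp add: r_def)
  have r2: "r\<^sup>2 * (real n * p / 2) = u"
    using n p(1) u by (simp add: r_def field_simps)
  define h where "h t z = (t * (snd z - g (fst z)) - t\<^sup>2 * s / 2) * indicator A (fst z)"
    for t and z :: "(real ^ 'd) \<times> real"
  \<comment> \<open>Projections are measurable for the product sigma-algebra, whereas the sample is
    stated with the Borel sets of the product type; \<open>borel_prod\<close> identifies the
    two.\<close>
  have "h t \<in> borel_measurable (borel \<Otimes>\<^sub>M borel)" for t
    unfolding h_def by measurable
  then have h [measurable]: "h t \<in> borel_measurable borel" for t
    by (simp add: borel_prod)
  have "(\<lambda>z. - indicator A (fst z) :: real) \<in> borel_measurable (borel \<Otimes>\<^sub>M (borel :: real measure))"
    by measurable
  then have h0 [measurable]: "(\<lambda>z :: (real ^ 'd) \<times> real. - indicator A (fst z) :: real) \<in> borel_measurable borel"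
    by (simp add: borel_prod)
  \<comment> \<open>The event of too few observations, with signs reversed so that a lower tail
    becomes the upper tail bounded by \<open>chernoff_iid\<close>.\<close>
  define E0 where "E0 = {\<omega>\<in>space M. - (real n * p / 2) \<le> (\<Sum>i=1..n. - indicator A (fst (Z i \<omega>)))}"
  define E where "E t = {\<omega>\<in>space M. u \<le> (\<Sum>i=1..n. h t (Z i \<omega>))}" for t
  have meas [measurable]: "E0 \<in> sets M" "E t \<in> sets M" for t
    unfolding E0_def E_def by measurable
  have "prob E0 \<le> exp (- (3/5) * p) ^ n * exp (- (- (real n * p / 2)))"
    unfolding E0_def
  proof (rule chernoff_iid[OF indep distr h0])
    show "(\<integral>\<^sup>+\<omega>. ennreal (exp (- indicator A (fst (Z 0 \<omega>)))) \<partial>M) \<le> ennreal (exp (- (3/5) * p))"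
      using exp_neg_indicator_le[OF X0 A p(2)] by (simp add: Z_def)
  qed simp
  \<comment> \<open>The rate 1/10 is the difference of 3/5 and 1/2.\<close>
  also have "\<dots> = exp (- (real n * p / 10))"
    by (simp flip: exp_of_nat_mult exp_add)
  finally have E0: "prob E0 \<le> exp (- (real n * p / 10))" .
  have Et: "prob (E t) \<le> exp (- u)" for t
  proof -
    have "prob (E t) \<le> 1 ^ n * exp (- u)"
      unfolding E_def
    proof (rule chernoff_iid[OF indep distr h])
      show "(\<integral>\<^sup>+\<omega>. ennreal (exp (h t (Z 0 \<omega>))) \<partial>M) \<le> ennreal 1"
        using cond_subgaussian_exp_le_1[OF X0 A sub, of t] by (simp add: Z_def h_def)
    qed simp
    then show ?thesis by simp
  qed
  show ?thesis
  proof (intro bexI conjI ballI)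
    show "E0 \<union> (E r \<union> E (- r)) \<in> sets M" by simp
    have "prob (E0 \<union> (E r \<union> E (- r))) \<le> prob E0 + (prob (E r) + prob (E (- r)))"
      by (intro order_trans[OF measure_Un_le] add_left_mono) (auto intro: measure_Un_le)
    then show "prob (E0 \<union> (E r \<union> E (- r))) \<le> exp (- (real n * p / 10)) + 2 * exp (- u)"
      using E0 Et[of r] Et[of "- r"] by simp
  next
    fix \<omega> assume \<omega>: "\<omega> \<in> space M - (E0 \<union> (E r \<union> E (- r)))"
    have S: "real n * p / 2 < S \<omega>"
      using \<omega> by (auto simp: E0_def S_def Z_def sum_negf)
    show "real n * p / 2 < S \<omega>" by fact
    have hsum: "(\<Sum>i=1..n. h t (Z i \<omega>)) = t * W \<omega> - t\<^sup>2 * s / 2 * S \<omega>" for t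
      unfolding W_def S_def sum_distrib_left sum_subtractf[symmetric]
      by (rule sum.cong) (simp_all add: h_def Z_def algebra_simps)
    \<comment> \<open>Replacing \<open>u\<close> by a multiple of the count leaves an inequality
      whose right side is proportional to \<open>S \<omega>\<close>; the \<open>1\<close> in
      \<open>s / 2 + 1\<close> comes from here.\<close>
    have "u < r\<^sup>2 * S \<omega>"
      unfolding r2[symmetric] using S r by (intro mult_strict_left_mono) auto
    moreover have "(\<Sum>i=1..n. h t (Z i \<omega>)) < u" if "t \<in> {r, - r}" for t
      using \<omega> that by (auto simp: E_def)
    ultimately have "t * W \<omega> < r * ((s / 2 + 1) * r * S \<omega>)" if "t \<in> {r, - r}" for t
      using that hsum[of t] by (fastforce simp: power2_eq_square algebra_simps)
    from this[of r] this[of "- r"] have "r * \<bar>W \<omega>\<bar> < r * ((s / 2 + 1) * r * S \<omega>)"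
      by (auto simp: abs_if)
    then show "\<bar>W \<omega>\<bar> \<le> (s / 2 + 1) * sqrt (2 * u / (real n * p)) * S \<omega>"
      using r by (simp add: r_def)
  qed
qed

lemma (in prob_space) prob_ge_density_bound:
  fixes X :: "'a \<Rightarrow> real ^ 'd::finite"
  assumes dens: "has_density_on_cube M X f" and b: "0 \<le> b" "\<And>u. u \<in> unit_cube \<Longrightarrow> b \<le> f u"
    and A [measurable]: "A \<in> sets borel" "A \<subseteq> unit_cube"
    and v: "ennreal v \<le> emeasure lborel A"
  shows "b * v \<le> prob {\<omega>\<in>space M. X \<omega> \<in> A}"
proof -
  have dist: "distributed M lborel X (\<lambda>u. ennreal (f u) * indicator unit_cube u)"
    using dens by (simp add: has_density_on_cube_def)
  have "ennreal (b * v) = ennreal b * ennreal v" using b(1) by (rule ennreal_mult')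
  also have "\<dots> \<le> ennreal b * emeasure lborel A"
    by (rule mult_left_mono[OF v]) simp
  also have "\<dots> = (\<integral>\<^sup>+u. ennreal b * indicator A u \<partial>lborel)"
    by (simp add: nn_integral_cmult_indicator)
  also have "\<dots> \<le> (\<integral>\<^sup>+u. ennreal (f u) * indicator unit_cube u * indicator A u \<partial>lborel)"
    using A(2) b(2) by (intro nn_integral_mono) (auto simp: indicator_def intro: ennreal_leI)
  also have "\<dots> = emeasure M (X -` A \<inter> space M)"
    using distributed_emeasure[OF dist, of A] A by simp
  also have "\<dots> = ennreal (prob {\<omega>\<in>space M. X \<omega> \<in> A})"
    by (simp add: emeasure_eq_measure vimage_def Int_def conj_commute)
  finally show ?thesis by simp
qed

section \<open>Depth of the tree\<close>

lemma tree_depth_le: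
  assumes "1 \<le> n"
  shows "real (tree_depth d n) \<le> real d * ln (real n) / ((real d + 2) * ln 2)"
proof -
  have "0 \<le> real d * ln (real n) / ((real d + 2) * ln 2)"
    using assms by (intro divide_nonneg_nonneg mult_nonneg_nonneg) auto
  then show ?thesis by (simp add: tree_depth_def)
qed

lemma tree_depth_gt: "real d * ln (real n) / ((real d + 2) * ln 2) < real (tree_depth d n) + 1"
  unfolding tree_depth_def by linarith

text \<open>Together with the volume of a cell this bounds the expected number of observations in it
  from below by a multiple of \<open>real n powr (2 / (real d + 2))\<close>.\<close>

lemma two_power_tree_depth_le:
  assumes "1 \<le> n"
  shows "2 ^ tree_depth d n \<le> real n powr (real d / (real d + 2))"
proof -
  have "(2::real) ^ tree_depth d n = exp (real (tree_depth d n) * ln 2)"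
    by (simp add: exp_of_nat_mult)
  also have "\<dots> \<le> exp (real d * ln (real n) / ((real d + 2) * ln 2) * ln 2)"
    unfolding exp_le_cancel_iff by (rule mult_right_mono[OF tree_depth_le[OF assms]]) simp
  also have "\<dots> = real n powr (real d / (real d + 2))"
    using assms by (simp add: powr_def)
  finally show ?thesis .
qed

text \<open>The left side counts direction words. From \<open>real d \<le> 2 ^ d\<close> it is at
  most \<open>(2 ^ tree_depth d n) ^ d\<close>, so the union bound costs only a polynomial
  factor.\<close>

lemma power_tree_depth_le:
  assumes "1 \<le> n"
  shows "real d ^ tree_depth d n \<le> real n ^ d"
proof -
  have "real d \<le> 2 ^ d"
    by (metis less_exp less_imp_le of_nat_le_iff of_nat_numeral of_nat_power)
  then have "real d ^ tree_depth d n \<le> (2 ^ d) ^ tree_depth d n"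
    by (rule power_mono) simp
  also have "\<dots> = (2 ^ tree_depth d n) ^ d"
    by (simp add: mult.commute flip: power_mult)
  also have "\<dots> \<le> real n ^ d"
  proof (rule power_mono)
    have "2 ^ tree_depth d n \<le> real n powr (real d / (real d + 2))"
      by (rule two_power_tree_depth_le[OF assms])
    also have "\<dots> \<le> real n powr 1" using assms by (intro powr_mono) auto
    finally show "2 ^ tree_depth d n \<le> real n" using assms by simp
  qed simp
  finally show ?thesis .
qed

lemma filterlim_tree_depth:
  assumes "0 < d"
  shows "filterlim (tree_depth d) sequentially sequentially"
proof -
  have "filterlim (\<lambda>n. real (tree_depth d n)) at_top sequentially"
  proof (rule filterlim_at_top_mono)
    show "filterlim (\<lambda>n. real d * ln (real n) / ((real d + 2) * ln 2) - 1) at_top sequentially"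
      using assms by real_asymp
    show "\<forall>\<^sub>F n in sequentially. real d * ln (real n) / ((real d + 2) * ln 2) - 1 \<le> real (tree_depth d n)"
      using tree_depth_gt[of d] by (intro always_eventually allI) (simp add: algebra_simps less_imp_le)
  qed
  then show ?thesis by (simp add: filterlim_sequentially_iff_filterlim_real)
qed

text \<open>The main term \<open>N / d\<close> yields the power of \<open>n\<close>, and the floor
  in the depth costs at most the factor 2. For the deviation, with \<open>l = ln (real n)\<close>,
  both \<open>real N \<le> 2 * l\<close> and \<open>ln (real N) \<le> 2 * ln l\<close> hold, which
  produces the 2 in the exponent of the rate.\<close>

lemma half_power_split_count_le:
  assumes d: "0 < d" and n: "1 \<le> n" "1 \<le> ln (ln (real n))"
    and T: "real (tree_depth d n) / real d - sqrt (real (tree_depth d n) * ln (real (tree_depth d n))) \<le> real T"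
  shows "(1/2) ^ T \<le> 2 * real n powr (- 1 / (real d + 2)) * exp (2 * sqrt (ln (real n) * ln (ln (real n))))"
proof -
  define N where "N = tree_depth d n"
  define l where "l = ln (real n)"
  have l: "0 < l" "1 \<le> ln l"
  proof -
    \<comment> \<open>By convention \<open>ln 0 = 0\<close>, so a nonzero logarithm excludes
      \<open>l = 0\<close>.\<close>
    have "ln l \<noteq> 0" using n(2) by (simp add: l_def)
    moreover have "0 \<le> l" using n(1) by (simp add: l_def)
    ultimately show "0 < l" by (cases "l = 0") auto
    show "1 \<le> ln l" using n(2) by (simp add: l_def)
  qed
  have ll: "0 \<le> l * ln l" using l by (intro mult_nonneg_nonneg) linarith+
  have ln2: "1 / 2 \<le> ln (2::real)" "ln (2::real) \<le> 1"
    using exp_half_le2 ln_ge_iff[of 2 "1 / 2"] ln_2_less_1 by auto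
  have "sqrt (real N * ln (real N)) \<le> sqrt (4 * (l * ln l))"
  proof (cases "N = 0")
    case False
    have "real N \<le> real d * l / ((real d + 2) * ln 2)"
      unfolding N_def l_def by (rule tree_depth_le[OF n(1)])
    also have "\<dots> = real d / (real d + 2) * (l / ln 2)" by simp
    also have "\<dots> \<le> 1 * (l / (1 / 2))"
      using ln2 l by (intro mult_mono divide_left_mono) auto
    finally have N: "real N \<le> 2 * l" by simp
    have "ln (real N) \<le> ln (2 * l)" using N False by simp
    also have "\<dots> = ln 2 + ln l" using l by (simp add: ln_mult)
    also have "\<dots> \<le> 2 * ln l" using ln2 l by linarith
    finally have "real N * ln (real N) \<le> 2 * l * (2 * ln l)"
      using N l False by (intro mult_mono) auto
    then show ?thesis by simp
  qed (use ll in simp)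
  also have "\<dots> = 2 * sqrt (l * ln l)" by (simp add: real_sqrt_mult)
  finally have dev: "sqrt (real N * ln (real N)) \<le> 2 * sqrt (l * ln l)" .
  have "real d * l / ((real d + 2) * ln 2) < real N + 1"
    unfolding N_def l_def by (rule tree_depth_gt)
  moreover have "0 < (real d + 2) * ln 2" by simp
  ultimately have "real d * l < (real N + 1) * ((real d + 2) * ln 2)"
    by (simp only: pos_divide_less_eq)
  then have "l / (real d + 2) \<le> ln 2 * (real N + 1) / real d"
    using d by (simp add: field_simps)
  also have "\<dots> = ln 2 * (real N / real d) + ln 2 * (1 / real d)"
    by (simp add: algebra_simps add_divide_distrib)
  also have "ln 2 * (1 / real d) \<le> ln (2::real) * 1"
    using d by (intro mult_left_mono) auto
  finally have main: "l / (real d + 2) \<le> ln 2 * (real N / real d) + ln 2" by simp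
  have "ln 2 * sqrt (real N * ln (real N)) \<le> ln 2 * (2 * sqrt (l * ln l))"
    by (rule mult_left_mono[OF dev]) simp
  also have "\<dots> \<le> 1 * (2 * sqrt (l * ln l))"
    using ln2(2) ll by (intro mult_right_mono) auto
  finally have "ln 2 * sqrt (real N * ln (real N)) \<le> 2 * sqrt (l * ln l)" by simp
  moreover have "ln 2 * (real N / real d - sqrt (real N * ln (real N))) \<le> ln 2 * real T"
    using T by (intro mult_left_mono) (auto simp: N_def)
  ultimately have "- (real T * ln 2) \<le> ln 2 + (- l / (real d + 2) + 2 * sqrt (l * ln l))"
    using main by (simp add: right_diff_distrib mult.commute)
  then have "exp (- (real T * ln 2)) \<le> exp (ln 2 + (- l / (real d + 2) + 2 * sqrt (l * ln l)))"
    by simp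
  moreover have "exp (- (real T * ln 2)) = (1/2) ^ T"
    by (simp add: exp_minus exp_of_nat_mult power_one_over inverse_eq_divide)
  moreover have "exp (ln 2 + (- l / (real d + 2) + 2 * sqrt (l * ln l)))
      = 2 * real n powr (- 1 / (real d + 2)) * exp (2 * sqrt (l * ln l))"
    unfolding exp_add using n(1) by (simp add: powr_def l_def)
  ultimately show ?thesis by (simp add: l_def)
qed

text \<open>The noise exceeds the power of \<open>n\<close> only by a factor
  \<open>sqrt (ln (real n))\<close>. The subexponential factor of the rate absorbs it, because the
  iterated logarithm is at least 1 and \<open>1 + y \<le> exp y\<close>.\<close>

lemma sqrt_noise_rate_le:
  assumes b: "0 < b" and n: "1 \<le> n" "1 \<le> ln (ln (real n))"
  shows "sqrt (2 * ((real d + 2) * ln (real n)) / (b * real n powr (2 / (real d + 2))))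
    \<le> sqrt (2 * (real d + 2) / b) * real n powr (- 1 / (real d + 2))
        * exp (2 * sqrt (ln (real n) * ln (ln (real n))))"
proof -
  have l: "0 \<le> ln (real n)" using n by simp
  have pw: "sqrt (real n powr (2 / (real d + 2))) = real n powr (1 / (real d + 2))"
  proof -
    have "real n powr (2 / (real d + 2)) = (real n powr (1 / (real d + 2)))\<^sup>2"
      by (simp add: power2_eq_square flip: powr_add)
    then show ?thesis by simp
  qed
  have "sqrt (2 * ((real d + 2) * ln (real n)) / (b * real n powr (2 / (real d + 2))))
      = sqrt (2 * (real d + 2) / b * ln (real n) / real n powr (2 / (real d + 2)))"
    by simp
  also have "\<dots> = sqrt (2 * (real d + 2) / b) * real n powr (- 1 / (real d + 2)) * sqrt (ln (real n))"
    unfolding real_sqrt_divide real_sqrt_mult pw by (simp add: powr_minus_divide)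
  also have "\<dots> \<le> sqrt (2 * (real d + 2) / b) * real n powr (- 1 / (real d + 2))
        * exp (2 * sqrt (ln (real n) * ln (ln (real n))))"
  proof (rule mult_left_mono)
    have "ln (real n) * 1 \<le> ln (real n) * ln (ln (real n))"
      using n l by (intro mult_left_mono) auto
    then have "sqrt (ln (real n)) \<le> sqrt (ln (real n) * ln (ln (real n)))" by simp
    also have "\<dots> \<le> 1 + 2 * sqrt (ln (real n) * ln (ln (real n)))"
      using n l by simp
    also have "\<dots> \<le> exp (2 * sqrt (ln (real n) * ln (ln (real n))))"
      by (rule exp_ge_add_one_self)
    finally show "sqrt (ln (real n)) \<le> exp (2 * sqrt (ln (real n) * ln (ln (real n))))" .
  qed (use b in simp)
  finally show ?thesis .
qed

section \<open>Almost sure bounds\<close>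

text \<open>The factor \<open>real n ^ d\<close> bounds the number of cells. The level
  \<open>(real d + 2) * ln (real n)\<close> turns the noise term into an inverse square after
  multiplication, and the count term decays faster than every power. The two contribute 2 and 1 to
  the constant 3.\<close>

lemma summable_union_bound:
  fixes b :: real
  assumes b: "0 < b"
  shows "summable (\<lambda>n. real n ^ d * (exp (- (b * real n powr (2 / (real d + 2)) / 10))
      + 2 * exp (- ((real d + 2) * ln (real n)))))"
proof (rule summable_comparison_test_ev)
  have "((\<lambda>n. real n powr (real d + 2) * exp (- (b * real n powr (2 / (real d + 2)) / 10)))
      \<longlongrightarrow> 0) sequentially"
    using b by real_asymp
  then have "\<forall>\<^sub>F n in sequentially.
      real n powr (real d + 2) * exp (- (b * real n powr (2 / (real d + 2)) / 10)) < 1"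
    by (rule order_tendstoD) simp
  then show "\<forall>\<^sub>F n in sequentially. norm (real n ^ d * (exp (- (b * real n powr (2 / (real d + 2)) / 10))
      + 2 * exp (- ((real d + 2) * ln (real n))))) \<le> 3 * inverse (real n ^ 2)"
    using eventually_gt_at_top[of 0]
  proof eventually_elim
    case (elim n)
    have pw: "real n powr (real d + 2) = real n ^ d * real n ^ 2"
      using elim by (simp add: powr_add powr_realpow)
    have "exp (- ((real d + 2) * ln (real n))) = inverse (real n ^ d * real n ^ 2)"
      using elim pw by (simp add: exp_minus powr_def)
    moreover have "real n ^ d * exp (- (b * real n powr (2 / (real d + 2)) / 10)) \<le> inverse (real n ^ 2)"
      using elim pw by (simp add: field_simps)
    ultimately show ?case
      using elim by (simp add: field_simps)
  qed
  show "summable (\<lambda>n. 3 * inverse (real n ^ 2))"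
    by (intro summable_mult inverse_power_summable) simp
qed

text \<open>The quantifier over \<open>\<delta>\<close> stands inside the almost sure statement, so
  a random direction sequence may later be substituted for each \<open>\<omega>\<close>.\<close>

lemma (in prob_space) all_cells_deviation:
  fixes X :: "nat \<Rightarrow> 'a \<Rightarrow> real ^ 'd::finite" and x :: "real ^ 'd"
  assumes iid: "iid_sample M X Y" and g: "g \<in> borel_measurable borel"
    and sub: "cond_subgaussian M (X 0) (\<lambda>\<omega>. Y 0 \<omega> - g (X 0 \<omega>)) s"
    and dens: "has_density_on_cube M (X 0) f" and b: "0 < b" "\<forall>u\<in>unit_cube. b \<le> f u"
  defines "V \<equiv> \<lambda>\<delta> n. centered_cell x \<delta> (tree_depth CARD('d) n)"
  shows "AE \<omega> in M. \<forall>\<^sub>F n in sequentially. \<forall>\<delta>.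
     0 < (\<Sum>i=1..n. indicator (V \<delta> n) (X i \<omega>) :: real) \<and>
     \<bar>\<Sum>i=1..n. (Y i \<omega> - g (X i \<omega>)) * indicator (V \<delta> n) (X i \<omega>)\<bar>
       \<le> (s / 2 + 1) * sqrt (2 * ((real CARD('d) + 2) * ln (real n)) / (b * real n powr (2 / (real CARD('d) + 2))))
           * (\<Sum>i=1..n. indicator (V \<delta> n) (X i \<omega>))"
proof -
  let ?d = "CARD('d)"
  define q where "q n = b * real n powr (2 / (real ?d + 2))" for n
  define u where "u n = (real ?d + 2) * ln (real n)" for n
  define good where "good n \<delta> \<omega> \<longleftrightarrow>
     q n / 2 < (\<Sum>i=1..n. indicator (V \<delta> n) (X i \<omega>)) \<and>
     \<bar>\<Sum>i=1..n. (Y i \<omega> - g (X i \<omega>)) * indicator (V \<delta> n) (X i \<omega>)\<bar>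
       \<le> (s / 2 + 1) * sqrt (2 * u n / q n) * (\<Sum>i=1..n. indicator (V \<delta> n) (X i \<omega>))" for n \<delta> \<omega>
  have "\<exists>E\<in>sets M. prob E \<le> exp (- (q n / 10)) + 2 * exp (- u n) \<and> (\<forall>\<omega>\<in>space M - E. good n \<delta> \<omega>)"
    if n: "2 \<le> n" for n \<delta>
  proof -
    \<comment> \<open>A lower bound for the probability of every cell at this depth. It is free of
      the floor, so \<open>real n * p\<close> is exactly \<open>q n\<close>.\<close>
    define p where "p = b * real n powr (- real ?d / (real ?d + 2))"
    have np: "real n * p = q n"
    proof -
      have "real n * real n powr (- real ?d / (real ?d + 2)) = real n powr (1 + - real ?d / (real ?d + 2))"
        using n by (subst powr_add) simp
      also have "1 + - real ?d / (real ?d + 2) = 2 / (real ?d + 2)"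
        by (simp add: field_simps)
      finally show ?thesis by (simp add: p_def q_def mult.left_commute)
    qed
    have "2 ^ tree_depth ?d n \<le> real n powr (real ?d / (real ?d + 2))"
      using n by (intro two_power_tree_depth_le) simp
    then have "inverse (real n powr (real ?d / (real ?d + 2))) \<le> inverse (2 ^ tree_depth ?d n)"
      by (intro le_imp_inverse_le) simp_all
    from mult_left_mono[OF this, of b] have "p \<le> b * (1/2) ^ tree_depth ?d n"
      using b(1) by (simp add: p_def powr_minus power_one_over inverse_eq_divide)
    also have "\<dots> \<le> prob {\<omega>\<in>space M. X 0 \<omega> \<in> V \<delta> n}"
      unfolding V_def using b
      by (intro prob_ge_density_bound[OF dens] centered_cell_borel centered_cell_subset
          emeasure_centered_cell) auto
    finally have p: "p \<le> prob {\<omega>\<in>space M. X 0 \<omega> \<in> V \<delta> n}" .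
    have "0 < p" "0 < n" "0 < u n" using n b(1) by (simp_all add: p_def u_def)
    then show ?thesis
      using sample_cell_deviation[OF iid g sub _ _ p, of n "u n"]
      by (simp add: np good_def V_def)
  qed
  then obtain E where E: "\<And>n \<delta>. 2 \<le> n \<Longrightarrow> E n \<delta> \<in> sets M"
    "\<And>n \<delta>. 2 \<le> n \<Longrightarrow> prob (E n \<delta>) \<le> exp (- (q n / 10)) + 2 * exp (- u n)"
    "\<And>n \<delta> \<omega>. 2 \<le> n \<Longrightarrow> \<omega> \<in> space M - E n \<delta> \<Longrightarrow> good n \<delta> \<omega>"
    by metis
  \<comment> \<open>Representatives of all direction sequences up to the current depth, made a
    finite set by extensionality outside that range.\<close>
  define words :: "nat \<Rightarrow> (nat \<Rightarrow> 'd) set" where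
    "words n = PiE {1..tree_depth ?d n} (\<lambda>_. UNIV)" for n
  have words: "finite (words n)" "card (words n) = ?d ^ tree_depth ?d n" for n
    by (auto simp: words_def card_PiE intro: finite_PiE)
  \<comment> \<open>At \<open>n = 1\<close> the level \<open>u n\<close> vanishes, so the deviation
    bound starts at 2.\<close>
  define Bad where "Bad n = (if 2 \<le> n then \<Union>\<delta>\<in>words n. E n \<delta> else {})" for n
  have Bad [measurable]: "Bad n \<in> sets M" for n
    using E(1) words by (auto simp: Bad_def)
  have prob_Bad: "prob (Bad n) \<le> real n ^ ?d * (exp (- (q n / 10)) + 2 * exp (- u n))" if n: "2 \<le> n" for n
  proof -
    have "prob (Bad n) \<le> (\<Sum>\<delta>\<in>words n. prob (E n \<delta>))"
      unfolding Bad_def using n E(1)[OF n] words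
      by (auto intro!: finite_measure_subadditive_finite)
    also have "\<dots> \<le> (\<Sum>\<delta>\<in>words n. exp (- (q n / 10)) + 2 * exp (- u n))"
      by (intro sum_mono E(2) n)
    also have "\<dots> = real ?d ^ tree_depth ?d n * (exp (- (q n / 10)) + 2 * exp (- u n))"
      by (simp add: words)
    also have "\<dots> \<le> real n ^ ?d * (exp (- (q n / 10)) + 2 * exp (- u n))"
      using n by (intro mult_right_mono power_tree_depth_le) auto
    finally show ?thesis .
  qed
  have "summable (\<lambda>n. prob (Bad n))"
  proof (rule summable_comparison_test_ev)
    show "\<forall>\<^sub>F n in sequentially. norm (prob (Bad n)) \<le> real n ^ ?d * (exp (- (q n / 10)) + 2 * exp (- u n))"
      using eventually_ge_at_top[of 2] by eventually_elim (simp add: prob_Bad)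
    show "summable (\<lambda>n. real n ^ ?d * (exp (- (q n / 10)) + 2 * exp (- u n)))"
      unfolding q_def u_def by (rule summable_union_bound[OF b(1)])
  qed
  then have "AE \<omega> in M. \<forall>\<^sub>F n in sequentially. \<omega> \<in> space M - Bad n"
    by (intro borel_cantelli_AE1) (auto simp: emeasure_eq_measure)
  then show ?thesis
  proof (rule eventually_mono)
    fix \<omega> assume "\<forall>\<^sub>F n in sequentially. \<omega> \<in> space M - Bad n"
    then show "\<forall>\<^sub>F n in sequentially. \<forall>\<delta>.
       0 < (\<Sum>i=1..n. indicator (V \<delta> n) (X i \<omega>) :: real) \<and>
       \<bar>\<Sum>i=1..n. (Y i \<omega> - g (X i \<omega>)) * indicator (V \<delta> n) (X i \<omega>)\<bar>
         \<le> (s / 2 + 1) * sqrt (2 * ((real ?d + 2) * ln (real n)) / (b * real n powr (2 / (real ?d + 2))))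
             * (\<Sum>i=1..n. indicator (V \<delta> n) (X i \<omega>))"
      using eventually_ge_at_top[of 2]
    proof eventually_elim
      case (elim n)
      show ?case
      proof
        fix \<delta> :: "nat \<Rightarrow> 'd"
        \<comment> \<open>Restriction gives a word with the same cell as \<open>\<delta>\<close>, so
          the bound for words covers every sequence.\<close>
        let ?\<delta> = "restrict \<delta> {1..tree_depth ?d n}"
        have "V \<delta> n = V ?\<delta> n"
          unfolding V_def by (rule centered_cell_cong) simp
        moreover have "?\<delta> \<in> words n" by (simp add: words_def)
        then have "good n ?\<delta> \<omega>"
          using elim by (intro E(3)) (auto simp: Bad_def)
        moreover have "0 \<le> q n" using b(1) by (simp add: q_def)
        ultimately show "0 < (\<Sum>i=1..n. indicator (V \<delta> n) (X i \<omega>) :: real) \<and>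
           \<bar>\<Sum>i=1..n. (Y i \<omega> - g (X i \<omega>)) * indicator (V \<delta> n) (X i \<omega>)\<bar>
             \<le> (s / 2 + 1) * sqrt (2 * ((real ?d + 2) * ln (real n)) / (b * real n powr (2 / (real ?d + 2))))
               * (\<Sum>i=1..n. indicator (V \<delta> n) (X i \<omega>))"
          unfolding good_def q_def[symmetric] u_def[symmetric] by auto
      qed
    qed
  qed
qed

text \<open>Hoeffding's inequality and Borel-Cantelli treat one direction at a time. There are
  finitely many directions, so one threshold for \<open>N\<close> then serves all of them.\<close>

lemma (in prob_space) split_count_ge:
  fixes D :: "nat \<Rightarrow> 'a \<Rightarrow> 'd::finite"
  assumes D: "iid_uniform_directions M D"
  shows "AE \<omega> in M. \<forall>\<^sub>F N in sequentially. \<forall>j.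
    real N / real CARD('d) - sqrt (real N * ln (real N)) \<le> real (split_count (\<lambda>i. D i \<omega>) N j)"
proof -
  have indep: "indep_vars (\<lambda>_. count_space UNIV) D {1..}"
    and distr: "\<And>i. 1 \<le> i \<Longrightarrow> distr M (count_space UNIV) (D i) = uniform_count_measure UNIV"
    using D by (simp_all add: iid_uniform_directions_def)
  have Dm: "D i \<in> M \<rightarrow>\<^sub>M count_space UNIV" if "1 \<le> i" for i
    using indep that by (simp add: indep_vars_def)
  have "AE \<omega> in M. \<forall>\<^sub>F N in sequentially.
    real N / real CARD('d) - sqrt (real N * ln (real N)) \<le> real (split_count (\<lambda>i. D i \<omega>) N j)" for j
  proof -
    \<comment> \<open>With this radius the squared deviation is \<open>N * ln N\<close> and the
      squared ranges sum to \<open>N\<close>, so the Hoeffding bound is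
      \<open>exp (- 2 * ln N)\<close>.\<close>
    define B where "B N = {\<omega>\<in>space M. (\<Sum>i\<in>{1..N}. indicator {j} (D i \<omega>))
        \<le> real N / real CARD('d) - sqrt (real N * ln (real N))}" for N
    have Im: "(\<lambda>\<omega>. indicator {j} (D i \<omega>) :: real) \<in> borel_measurable M" if "1 \<le> i" for i
      by (rule measurable_compose[OF Dm[OF that]]) simp
    have "(\<lambda>\<omega>. \<Sum>i\<in>{1..N}. indicator {j} (D i \<omega>) :: real) \<in> borel_measurable M" for N
      by (rule borel_measurable_sum) (simp add: Im)
    from borel_measurable_le[OF this borel_measurable_const]
    have B [measurable]: "B N \<in> sets M" for N
      by (simp add: B_def)
    have expect: "expectation (\<lambda>\<omega>. indicator {j} (D i \<omega>)) = 1 / real CARD('d)" if i: "1 \<le> i" for i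
    proof -
      have "expectation (\<lambda>\<omega>. indicator {j} (D i \<omega>)) = (\<integral>z. (indicator {j} z :: real) \<partial>distr M (count_space UNIV) (D i))"
        by (rule integral_distr[symmetric]) (use Dm[OF i] in auto)
      also have "\<dots> = measure (uniform_count_measure UNIV) {j}"
        by (simp add: distr[OF i])
      also have "\<dots> = 1 / real CARD('d)"
        by (subst measure_uniform_count_measure) auto
      finally show ?thesis .
    qed
    have prob_B: "prob (B N) \<le> inverse (real N ^ 2)" if N: "1 \<le> N" for N
    proof -
      have indepN: "indep_vars (\<lambda>_. borel) (\<lambda>i \<omega>. indicator {j} (D i \<omega>) :: real) {1..N}"
        by (rule indep_vars_compose2[OF indep_vars_subset[OF indep]]) auto
      have "(\<Sum>i\<in>{1..N}. expectation (\<lambda>\<omega>. indicator {j} (D i \<omega>))) = (\<Sum>i\<in>{1..N}. 1 / real CARD('d))"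
        by (rule sum.cong) (auto intro!: expect)
      then have mean: "(\<Sum>i\<in>{1..N}. expectation (\<lambda>\<omega>. indicator {j} (D i \<omega>))) = real N / real CARD('d)"
        by simp
      interpret H: Hoeffding_ineq M "{1..N}" "\<lambda>i \<omega>. indicator {j} (D i \<omega>)" "\<lambda>_. 0" "\<lambda>_. 1"
        "real N / real CARD('d)"
      proof unfold_locales
        show "real N / real CARD('d) \<equiv> (\<Sum>i\<in>{1..N}. expectation (\<lambda>\<omega>. indicator {j} (D i \<omega>)))"
          using mean by (simp only: atomize_eq)
      qed (use indepN in \<open>auto simp: indicator_def\<close>)
      have "prob (B N) \<le> exp (- 2 * (sqrt (real N * ln (real N)))\<^sup>2 / (\<Sum>i\<in>{1..N}. (1 - 0)\<^sup>2))"
        unfolding B_def by (rule H.Hoeffding_ineq_le) (use N in auto)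
      also have "\<dots> = exp (- (2 * ln (real N)))"
        using N by (simp add: field_simps)
      also have "\<dots> = inverse (real N ^ 2)"
        using N by (simp add: exp_minus exp_of_nat_mult[of 2, simplified])
      finally show ?thesis .
    qed
    have "summable (\<lambda>N. prob (B N))"
    proof (rule summable_comparison_test_ev)
      show "\<forall>\<^sub>F N in sequentially. norm (prob (B N)) \<le> inverse (real N ^ 2)"
        using eventually_ge_at_top[of 1] by eventually_elim (simp add: prob_B)
      show "summable (\<lambda>N. inverse (real N ^ 2))"
        by (rule inverse_power_summable) simp
    qed
    then have "AE \<omega> in M. \<forall>\<^sub>F N in sequentially. \<omega> \<in> space M - B N"
      by (intro borel_cantelli_AE1) (auto simp: emeasure_eq_measure)
    then show ?thesis
    proof (rule eventually_mono)
      fix \<omega> assume "\<forall>\<^sub>F N in sequentially. \<omega> \<in> space M - B N"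
      then show "\<forall>\<^sub>F N in sequentially.
        real N / real CARD('d) - sqrt (real N * ln (real N)) \<le> real (split_count (\<lambda>i. D i \<omega>) N j)"
        by eventually_elim (auto simp: B_def real_split_count)
    qed
  qed
  then have "AE \<omega> in M. \<forall>j. \<forall>\<^sub>F N in sequentially.
    real N / real CARD('d) - sqrt (real N * ln (real N)) \<le> real (split_count (\<lambda>i. D i \<omega>) N j)"
    by (simp add: AE_all_countable)
  then show ?thesis
    by (rule eventually_mono) (simp add: eventually_all_finite)
qed

theorem theorem28:
  fixes \<sigma> b L :: real
  assumes "b > 0"
  shows "\<exists>C>0. \<forall>(M :: 'a measure) (X :: nat \<Rightarrow> 'a \<Rightarrow> real ^ 'd::finite) (Y :: nat \<Rightarrow> 'a \<Rightarrow> real)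
            (D :: nat \<Rightarrow> 'a \<Rightarrow> 'd) (g :: real ^ 'd \<Rightarrow> real) (f\<^sub>X :: real ^ 'd \<Rightarrow> real) (x :: real ^ 'd).
      prob_space M \<longrightarrow>
      x \<in> unit_cube \<longrightarrow>
      iid_sample M X Y \<longrightarrow>
      iid_uniform_directions M D \<longrightarrow>
      directions_indep_of_data M D X Y \<longrightarrow>
      regression_function M (X 0) (Y 0) g \<longrightarrow>
      cond_subgaussian M (X 0) (\<lambda>\<omega>. Y 0 \<omega> - g (X 0 \<omega>)) (\<sigma>\<^sup>2) \<longrightarrow>
      has_density_on_cube M (X 0) f\<^sub>X \<longrightarrow>
      (\<forall>u\<in>unit_cube. f\<^sub>X u \<ge> b) \<longrightarrow>
      L-lipschitz_on unit_cube g \<longrightarrow>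
      (AE \<omega> in M. \<exists>n\<^sub>0. \<forall>n\<ge>n\<^sub>0.
         \<bar>cell_estimator (centered_cell x (\<lambda>i. D i \<omega>) (tree_depth CARD('d) n))
             (\<lambda>i. X i \<omega>) (\<lambda>i. Y i \<omega>) n - g x\<bar>
           \<le> C * real n powr (- 1 / (real CARD('d) + 2))
               * exp (2 * sqrt (ln (real n) * ln (ln (real n)))))"
proof (intro exI conjI allI impI)
  define d where "d = CARD('d)"
  \<comment> \<open>The first summand comes from the noise. The second comes from the bias:
    \<open>d\<close> side lengths, each at most twice the rate. The absolute value makes the
    constant positive before the Lipschitz hypothesis supplies \<open>0 \<le> L\<close>.\<close>
  define K where "K = (\<sigma>\<^sup>2 / 2 + 1) * sqrt (2 * (real d + 2) / b) + 2 * \<bar>L\<bar> * real d"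
  have d: "0 < d" by (simp add: d_def)
  have s: "0 < \<sigma>\<^sup>2 / 2 + 1" by (intro add_nonneg_pos) auto
  show "0 < K"
    unfolding K_def by (rule add_pos_nonneg[OF mult_pos_pos[OF s]]) (use assms in auto)
  fix M :: "'a measure" and X :: "nat \<Rightarrow> 'a \<Rightarrow> real ^ 'd" and Y :: "nat \<Rightarrow> 'a \<Rightarrow> real"
    and D :: "nat \<Rightarrow> 'a \<Rightarrow> 'd" and g f\<^sub>X :: "real ^ 'd \<Rightarrow> real" and x :: "real ^ 'd"
  assume M: "prob_space M" and x: "x \<in> unit_cube" and iid: "iid_sample M X Y"
    and D: "iid_uniform_directions M D" and reg: "regression_function M (X 0) (Y 0) g"
    and sub: "cond_subgaussian M (X 0) (\<lambda>\<omega>. Y 0 \<omega> - g (X 0 \<omega>)) (\<sigma>\<^sup>2)"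
    and dens: "has_density_on_cube M (X 0) f\<^sub>X" and f: "\<forall>u\<in>unit_cube. f\<^sub>X u \<ge> b"
    and g: "L-lipschitz_on unit_cube g"
  interpret prob_space M by (rule M)
  have L: "0 \<le> L" using g by (rule lipschitz_on_nonneg)
  have gm: "g \<in> borel_measurable borel"
    using reg by (simp add: regression_function_def)
  have ev: "\<forall>\<^sub>F n in sequentially. 1 \<le> ln (ln (real n))"
    by real_asymp
  from all_cells_deviation[OF iid gm sub dens assms f, of x] split_count_ge[OF D]
  show "AE \<omega> in M. \<exists>n\<^sub>0. \<forall>n\<ge>n\<^sub>0.
         \<bar>cell_estimator (centered_cell x (\<lambda>i. D i \<omega>) (tree_depth CARD('d) n))
             (\<lambda>i. X i \<omega>) (\<lambda>i. Y i \<omega>) n - g x\<bar>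
           \<le> K * real n powr (- 1 / (real CARD('d) + 2))
               * exp (2 * sqrt (ln (real n) * ln (ln (real n))))"
    unfolding eventually_sequentially[symmetric] d_def[symmetric]
  proof eventually_elim
    fix \<omega>
    assume noise: "\<forall>\<^sub>F n in sequentially. \<forall>\<delta>.
       0 < (\<Sum>i=1..n. indicator (centered_cell x \<delta> (tree_depth d n)) (X i \<omega>) :: real) \<and>
       \<bar>\<Sum>i=1..n. (Y i \<omega> - g (X i \<omega>)) * indicator (centered_cell x \<delta> (tree_depth d n)) (X i \<omega>)\<bar>
         \<le> (\<sigma>\<^sup>2 / 2 + 1) * sqrt (2 * ((real d + 2) * ln (real n)) / (b * real n powr (2 / (real d + 2))))
             * (\<Sum>i=1..n. indicator (centered_cell x \<delta> (tree_depth d n)) (X i \<omega>))"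
      and count: "\<forall>\<^sub>F N in sequentially. \<forall>j.
         real N / real d - sqrt (real N * ln (real N)) \<le> real (split_count (\<lambda>i. D i \<omega>) N j)"
    \<comment> \<open>The split counts are controlled for all large depths. Since the depth tends to
      infinity with \<open>n\<close>, the same holds along the depths of the trees, although many
      \<open>n\<close> share one depth.\<close>
    from noise eventually_compose_filterlim[OF count filterlim_tree_depth[OF d]] ev eventually_ge_at_top[of 1]
    show "\<forall>\<^sub>F n in sequentially. \<bar>cell_estimator (centered_cell x (\<lambda>i. D i \<omega>) (tree_depth d n))
             (\<lambda>i. X i \<omega>) (\<lambda>i. Y i \<omega>) n - g x\<bar>
           \<le> K * real n powr (- 1 / (real d + 2)) * exp (2 * sqrt (ln (real n) * ln (ln (real n))))"
    proof eventually_elim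
      case (elim n)
      let ?V = "centered_cell x (\<lambda>i. D i \<omega>) (tree_depth d n)"
      define R where "R = real n powr (- 1 / (real d + 2)) * exp (2 * sqrt (ln (real n) * ln (ln (real n))))"
      define \<eta> where "\<eta> = (\<sigma>\<^sup>2 / 2 + 1)
          * sqrt (2 * ((real d + 2) * ln (real n)) / (b * real n powr (2 / (real d + 2))))"
      have "\<bar>g z - g x\<bar> \<le> L * (real d * (2 * R))" if z: "z \<in> ?V" for z
      proof -
        have "z \<in> unit_cube" using z centered_cell_subset by blast
        then have "\<bar>g z - g x\<bar> \<le> L * norm (z - x)"
          using lipschitz_onD[OF g, of z x] x by (simp add: dist_norm)
        also have "norm (z - x) \<le> (\<Sum>j\<in>UNIV. (1/2) ^ split_count (\<lambda>i. D i \<omega>) (tree_depth d n) j)"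
          by (rule centered_cell_norm_le[OF z centered_cell_mem[OF x]])
        also have "\<dots> \<le> (\<Sum>j\<in>(UNIV :: 'd set). 2 * R)"
        proof (rule sum_mono)
          fix j :: 'd
          show "(1/2) ^ split_count (\<lambda>i. D i \<omega>) (tree_depth d n) j \<le> 2 * R"
            using half_power_split_count_le[OF d elim(4,3)] elim(2) by (simp add: R_def mult.assoc)
        qed
        finally show ?thesis using L by (simp add: d_def mult_left_mono)
      qed
      \<comment> \<open>The uniform bound is used at the realized directions,
        \<open>\<delta> = (\<lambda>i. D i \<omega>)\<close>.\<close>
      moreover have "0 < (\<Sum>i=1..n. indicator ?V (X i \<omega>) :: real)"
        and "\<bar>\<Sum>i=1..n. (Y i \<omega> - g (X i \<omega>)) * indicator ?V (X i \<omega>)\<bar>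
          \<le> \<eta> * (\<Sum>i=1..n. indicator ?V (X i \<omega>))"
        using elim(1) unfolding \<eta>_def by blast+
      ultimately have "\<bar>cell_estimator ?V (\<lambda>i. X i \<omega>) (\<lambda>i. Y i \<omega>) n - g x\<bar> \<le> \<eta> + L * (real d * (2 * R))"
        by (rule cell_estimator_error_le)
      also have "\<eta> \<le> (\<sigma>\<^sup>2 / 2 + 1) * (sqrt (2 * (real d + 2) / b) * R)"
        unfolding \<eta>_def R_def mult.assoc[of "sqrt (2 * (real d + 2) / b)", symmetric]
        by (rule mult_left_mono[OF sqrt_noise_rate_le[OF assms elim(4,3)]]) simp
      finally show ?case using L by (simp add: K_def R_def algebra_simps)
    qed
  qed
qed

end
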